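(* Let $K$ be a field. As a $2$-$As$ algebra over $K$, $(\mathcal{H}_{\mathcal{DP}},\rightsquigarrow,\natural)$ is freely generated by the set of nonempty $1,2$-indecomposable double posets. That is, for every $2$-$As$ algebra $(A,\cdot,* )$ over $K$ and every family $(a_P)$ of elements of $A$ indexed by the nonempty $1,2$-indecomposable double posets $P$ (up to isomorphism), there exists a unique morphism of $2$-$As$ algebras $\phi:\mathcal{H}_{\mathcal{DP}}\longrightarrow A$ such that $\phi(P)=a_P$ for every nonempty $1,2$-indecomposable double poset $P$.
   Context: A double poset is a triple $(P,\leq_1,\leq_2)$ where $P$ is a finite set and $\leq_1,\leq_2$ are two partial orders on $P$. $\mathcal{DP}$ is the set of isomorphism classes of double posets (double posets are identified with their classes); the class of the empty double poset is denoted $1$. A subset of a double poset, with the two restricted orders, is called a double subposet. For $P,Q\in\mathcal{DP}$: $P\rightsquigarrow Q$ is the disjoint union of $P$ and $Q$, with $P$ and $Q$ as double subposets, and for all $x\in P$, $y\in Q$: $x\leq_2 y$ and $x,y$ are not comparable for $\leq_1$. Similarly $P\natural Q$ is the disjoint union of $P$ and $Q$, with $P$ and $Q$ as double subposets, and for all $x\in P$, $y\in Q$: $x\leq_1 y$ and $x,y$ are not comparable for $\leq_2$. Both products are associative with unit $1$. $\mathcal{H}_{\mathcal{DP}}$ is the $K$-vector space with basis $\mathcal{DP}$; $\rightsquigarrow$ and $\natural$ are extended bilinearly. A $2$-$As$ algebra is a $K$-vector space with two associative products sharing the same unit; morphisms are linear maps preserving both products and the unit. A double poset $P$ is $1$-indecomposable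 if the only subsets $I\subseteq P$ such that for all $x\in I$, $y\in P\setminus I$, $x\leq_2 y$ and $x,y$ are not $\leq_1$-comparable, are $I=\emptyset$ and $I=P$. It is $2$-indecomposable if the only subsets $I\subseteq P$ such that for all $x\in I$, $y\in P\setminus I$, $x\leq_1 y$ and $x,y$ are not $\leq_2$-comparable, are $I=\emptyset$ and $I=P$. It is $1,2$-indecomposable if it is both $1$- and $2$-indecomposable. *)

theory Defs
  imports Complex_Main "HOL-Library.Poly_Mapping" "HOL-Library.Nat_Bijection"
begin

section \<open>Double posets\<close>

record 'a dposet =
  carr :: "'a set"
  ord1 :: "'a rel"
  ord2 :: "'a rel"

definition double_poset :: "'a dposet \<Rightarrow> bool" where
  "double_poset P \<longleftrightarrow>
     finite (carr P) \<and> partial_order_on (carr P) (ord1 P) \<and> partial_order_on (carr P) (ord2 P)"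

definition dposet_iso :: "('a \<Rightarrow> 'b) \<Rightarrow> 'a dposet \<Rightarrow> 'b dposet \<Rightarrow> bool" where
  "dposet_iso f P Q \<longleftrightarrow> bij_betw f (carr P) (carr Q) \<and>
     (\<forall>x\<in>carr P. \<forall>y\<in>carr P.
        ((x, y) \<in> ord1 P \<longleftrightarrow> (f x, f y) \<in> ord1 Q) \<and>
        ((x, y) \<in> ord2 P \<longleftrightarrow> (f x, f y) \<in> ord2 Q))"

definition dposet_isomorphic :: "'a dposet \<Rightarrow> 'b dposet \<Rightarrow> bool" where
  "dposet_isomorphic P Q \<longleftrightarrow> (\<exists>f. dposet_iso f P Q)"

definition empty_dposet :: "'a dposet" where
  "empty_dposet = \<lparr>carr = {}, ord1 = {}, ord2 = {}\<rparr>"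

text \<open>Disjoint unions live on the sum type; \<open>P <+> Q\<close> is the tagged union, and
  \<open>sum_rel r s\<close> leaves the two summands incomparable.\<close>

definition sum_rel :: "'a rel \<Rightarrow> 'b rel \<Rightarrow> ('a + 'b) rel" where
  "sum_rel r s = {(Inl x, Inl x') | x x'. (x, x') \<in> r} \<union> {(Inr y, Inr y') | y y'. (y, y') \<in> s}"

definition ordsum_rel :: "'a set \<Rightarrow> 'b set \<Rightarrow> 'a rel \<Rightarrow> 'b rel \<Rightarrow> ('a + 'b) rel" where
  "ordsum_rel A B r s = sum_rel r s \<union> {(Inl x, Inr y) | x y. x \<in> A \<and> y \<in> B}"

definition leadsto_dposet :: "'a dposet \<Rightarrow> 'b dposet \<Rightarrow> ('a + 'b) dposet" where
  "leadsto_dposet P Q =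
     \<lparr>carr = carr P <+> carr Q,
      ord1 = sum_rel (ord1 P) (ord1 Q),
      ord2 = ordsum_rel (carr P) (carr Q) (ord2 P) (ord2 Q)\<rparr>"

definition natural_dposet :: "'a dposet \<Rightarrow> 'b dposet \<Rightarrow> ('a + 'b) dposet" where
  "natural_dposet P Q =
     \<lparr>carr = carr P <+> carr Q,
      ord1 = ordsum_rel (carr P) (carr Q) (ord1 P) (ord1 Q),
      ord2 = sum_rel (ord2 P) (ord2 Q)\<rparr>"

definition indecomposable1_dposet :: "'a dposet \<Rightarrow> bool" where
  "indecomposable1_dposet P \<longleftrightarrow>
     (\<forall>I \<subseteq> carr P.
        (\<forall>x\<in>I. \<forall>y\<in>carr P - I.
           (x, y) \<in> ord2 P \<and> (x, y) \<notin> ord1 P \<and> (y, x) \<notin> ord1 P) \<longrightarrow>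
        I = {} \<or> I = carr P)"

definition indecomposable2_dposet :: "'a dposet \<Rightarrow> bool" where
  "indecomposable2_dposet P \<longleftrightarrow>
     (\<forall>I \<subseteq> carr P.
        (\<forall>x\<in>I. \<forall>y\<in>carr P - I.
           (x, y) \<in> ord1 P \<and> (x, y) \<notin> ord2 P \<and> (y, x) \<notin> ord2 P) \<longrightarrow>
        I = {} \<or> I = carr P)"

text \<open>Transport of structure along a map; only used for injective \<open>f\<close>.\<close>

definition relabel :: "('a \<Rightarrow> 'b) \<Rightarrow> 'a dposet \<Rightarrow> 'b dposet" where
  "relabel f P =
     \<lparr>carr = f ` carr P, ord1 = map_prod f f ` ord1 P, ord2 = map_prod f f ` ord2 P\<rparr>"

lemma dposet_iso_refl: "dposet_iso id P P"
  by (simp add: dposet_iso_def)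

lemma dposet_iso_sym:
  assumes "dposet_iso f P Q"
  shows "dposet_iso (inv_into (carr P) f) Q P"
proof -
  let ?g = "inv_into (carr P) f"
  have bij: "bij_betw f (carr P) (carr Q)" using assms by (simp add: dposet_iso_def)
  have "?g x \<in> carr P" "f (?g x) = x" if "x \<in> carr Q" for x
    using bij_betwE[OF bij_betw_inv_into[OF bij]] bij_betw_inv_into_right[OF bij] that by blast+
  then show ?thesis
    using assms bij_betw_inv_into[OF bij] by (simp add: dposet_iso_def)
qed

lemma dposet_iso_trans: "dposet_iso f P Q \<Longrightarrow> dposet_iso g Q R \<Longrightarrow> dposet_iso (g \<circ> f) P R"
  unfolding dposet_iso_def by (auto intro: bij_betw_trans dest: bij_betwE)

lemma dposet_iso_relabel:
  assumes "double_poset P" "inj_on f (carr P)"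
  shows "dposet_iso f P (relabel f P)"
proof -
  have *: "(x, y) \<in> r \<longleftrightarrow> (f x, f y) \<in> map_prod f f ` r"
    if "r \<subseteq> carr P \<times> carr P" "x \<in> carr P" "y \<in> carr P" for r x y
  proof
    assume "(f x, f y) \<in> map_prod f f ` r"
    then obtain x' y' where "(x', y') \<in> r" "f x = f x'" "f y = f y'" by auto
    moreover from this have "x = x'" "y = y'"
      using that assms(2) by (auto dest: inj_onD)
    ultimately show "(x, y) \<in> r" by simp
  qed force
  show ?thesis
    using assms *[of "ord1 P"] *[of "ord2 P"]
    by (simp add: dposet_iso_def relabel_def bij_betw_def double_poset_def
        partial_order_on_def preorder_on_def)
qed

lemma partial_order_on_relabel:
  assumes "partial_order_on A r" "inj_on f A"
  shows "partial_order_on (f ` A) (map_prod f f ` r)"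
proof -
  have sub: "r \<subseteq> A \<times> A" and re: "refl_on A r" and tr: "trans r" and an: "antisym r"
    using assms(1) by (auto simp: partial_order_on_def preorder_on_def)
  have "trans (map_prod f f ` r)"
  proof (rule transI)
    fix x y z
    assume xy: "(x, y) \<in> map_prod f f ` r" and yz: "(y, z) \<in> map_prod f f ` r"
    obtain a b where ab: "(a, b) \<in> r" "x = f a" "y = f b" using xy by auto
    obtain b' c where bc: "(b', c) \<in> r" "y = f b'" "z = f c" using yz by auto
    have "b = b'" using ab bc assms(2) sub by (auto dest: inj_onD)
    then have "(a, c) \<in> r" using ab bc tr by (auto dest: transD)
    then show "(x, z) \<in> map_prod f f ` r" using ab bc by force
  qed
  moreover have "antisym (map_prod f f ` r)"
  proof (rule antisymI)
    fix x y
    assume xy: "(x, y) \<in> map_prod f f ` r" and yx: "(y, x) \<in> map_prod f f ` r"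
    obtain a b where ab: "(a, b) \<in> r" "x = f a" "y = f b" using xy by auto
    obtain b' a' where ba: "(b', a') \<in> r" "y = f b'" "x = f a'" using yx by auto
    have "b = b'" using ab ba assms(2) sub by (auto dest: inj_onD)
    moreover have "a = a'" using ab ba assms(2) sub by (auto dest: inj_onD)
    ultimately show "x = y" using ab ba an by (auto dest: antisymD)
  qed
  ultimately show ?thesis
    using sub re by (auto simp: partial_order_on_def preorder_on_def refl_on_def)
qed

lemma double_poset_relabel:
  "double_poset P \<Longrightarrow> inj_on f (carr P) \<Longrightarrow> double_poset (relabel f P)"
  unfolding double_poset_def
  by (auto simp: relabel_def intro: partial_order_on_relabel)

text \<open>No generality is lost below by only using subsets of \<open>nat\<close> as underlying sets.\<close>

lemma double_poset_nat_copy: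
  assumes "double_poset P"
  shows "\<exists>Q :: nat dposet. double_poset Q \<and> dposet_isomorphic P Q"
proof -
  obtain f :: "'a \<Rightarrow> nat" where "inj_on f (carr P)"
    using assms finite_imp_inj_to_nat_seg unfolding double_poset_def by metis
  then show ?thesis
    using assms dposet_iso_relabel double_poset_relabel unfolding dposet_isomorphic_def by blast
qed

lemma sum_rel_iff [simp]:
  "(Inl x, Inl x') \<in> sum_rel r s \<longleftrightarrow> (x, x') \<in> r"
  "(Inr y, Inr y') \<in> sum_rel r s \<longleftrightarrow> (y, y') \<in> s"
  "(Inl x, Inr y) \<notin> sum_rel r s"
  "(Inr y, Inl x) \<notin> sum_rel r s"
  by (auto simp: sum_rel_def)

lemma ordsum_rel_iff [simp]:
  "(Inl x, Inl x') \<in> ordsum_rel A B r s \<longleftrightarrow> (x, x') \<in> r"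
  "(Inr y, Inr y') \<in> ordsum_rel A B r s \<longleftrightarrow> (y, y') \<in> s"
  "(Inl x, Inr y) \<in> ordsum_rel A B r s \<longleftrightarrow> x \<in> A \<and> y \<in> B"
  "(Inr y, Inl x) \<notin> ordsum_rel A B r s"
  by (auto simp: ordsum_rel_def)

lemma partial_order_on_iff:
  "partial_order_on A r \<longleftrightarrow>
     (\<forall>x y. (x, y) \<in> r \<longrightarrow> x \<in> A \<and> y \<in> A) \<and> (\<forall>x\<in>A. (x, x) \<in> r) \<and>
     (\<forall>x y z. (x, y) \<in> r \<longrightarrow> (y, z) \<in> r \<longrightarrow> (x, z) \<in> r) \<and>
     (\<forall>x y. (x, y) \<in> r \<longrightarrow> (y, x) \<in> r \<longrightarrow> x = y)"
  unfolding partial_order_on_def preorder_on_def refl_on_def trans_def antisym_def by auto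

lemma partial_order_on_sum_rel:
  assumes "partial_order_on A r" "partial_order_on B s"
  shows "partial_order_on (A <+> B) (sum_rel r s)"
  using assms
  unfolding partial_order_on_iff split_sum_all by (simp add: Plus_def image_iff ball_Un)

lemma partial_order_on_ordsum_rel:
  assumes "partial_order_on A r" "partial_order_on B s"
  shows "partial_order_on (A <+> B) (ordsum_rel A B r s)"
  using assms
  unfolding partial_order_on_iff split_sum_all by (simp add: Plus_def image_iff ball_Un)

lemma double_poset_empty: "double_poset empty_dposet"
  by (simp add: double_poset_def empty_dposet_def partial_order_on_def preorder_on_def
      refl_on_def trans_def antisym_def)

lemma double_poset_leadsto:
  "double_poset P \<Longrightarrow> double_poset Q \<Longrightarrow> double_poset (leadsto_dposet P Q)"
  by (simp add: double_poset_def leadsto_dposet_def partial_order_on_sum_rel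
      partial_order_on_ordsum_rel)

lemma double_poset_natural:
  "double_poset P \<Longrightarrow> double_poset Q \<Longrightarrow> double_poset (natural_dposet P Q)"
  by (simp add: double_poset_def natural_dposet_def partial_order_on_sum_rel
      partial_order_on_ordsum_rel)

lemma bij_betw_map_sum:
  assumes "bij_betw f A A'" "bij_betw g B B'"
  shows "bij_betw (map_sum f g) (A <+> B) (A' <+> B')"
proof -
  have "map_sum f g ` (A <+> B) = f ` A <+> g ` B"
    by (simp add: Plus_def image_Un image_image)
  moreover have "inj_on (map_sum f g) (A <+> B)"
    using assms by (simp add: bij_betw_def inj_on_def Plus_def ball_Un)
  ultimately show ?thesis
    using assms by (simp add: bij_betw_def)
qed

lemma dposet_iso_leadsto:
  assumes "dposet_iso f P P'" "dposet_iso g Q Q'"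
  shows "dposet_iso (map_sum f g) (leadsto_dposet P Q) (leadsto_dposet P' Q')"
proof -
  have "bij_betw (map_sum f g) (carr P <+> carr Q) (carr P' <+> carr Q')"
    using assms by (simp add: bij_betw_map_sum dposet_iso_def)
  moreover have "\<forall>x\<in>carr P. f x \<in> carr P'" "\<forall>y\<in>carr Q. g y \<in> carr Q'"
    using assms by (auto simp: dposet_iso_def dest: bij_betwE)
  ultimately show ?thesis
    using assms unfolding dposet_iso_def leadsto_dposet_def by (simp add: Plus_def ball_Un)
qed

lemma dposet_iso_natural:
  assumes "dposet_iso f P P'" "dposet_iso g Q Q'"
  shows "dposet_iso (map_sum f g) (natural_dposet P Q) (natural_dposet P' Q')"
proof -
  have "bij_betw (map_sum f g) (carr P <+> carr Q) (carr P' <+> carr Q')"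
    using assms by (simp add: bij_betw_map_sum dposet_iso_def)
  moreover have "\<forall>x\<in>carr P. f x \<in> carr P'" "\<forall>y\<in>carr Q. g y \<in> carr Q'"
    using assms by (auto simp: dposet_iso_def dest: bij_betwE)
  ultimately show ?thesis
    using assms unfolding dposet_iso_def natural_dposet_def by (simp add: Plus_def ball_Un)
qed

lemma dposet_isomorphic_relabel_cong:
  assumes "dposet_isomorphic P Q" "double_poset P" "double_poset Q"
    "inj_on f (carr P)" "inj_on g (carr Q)"
  shows "dposet_isomorphic (relabel f P) (relabel g Q)"
proof -
  obtain h where h: "dposet_iso h P Q" using assms(1) by (auto simp: dposet_isomorphic_def)
  have f: "dposet_iso f P (relabel f P)" and g: "dposet_iso g Q (relabel g Q)"
    using assms by (simp_all add: dposet_iso_relabel)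
  show ?thesis
    unfolding dposet_isomorphic_def
    by (intro exI) (rule dposet_iso_trans[OF dposet_iso_sym[OF f] dposet_iso_trans[OF h g]])
qed

lemma indecomposable1_iso:
  assumes f: "dposet_iso f P Q" and P: "indecomposable1_dposet P"
  shows "indecomposable1_dposet Q"
  unfolding indecomposable1_dposet_def
proof (intro allI impI)
  fix I assume I: "I \<subseteq> carr Q" and
    sep: "\<forall>x\<in>I. \<forall>y\<in>carr Q - I. (x, y) \<in> ord2 Q \<and> (x, y) \<notin> ord1 Q \<and> (y, x) \<notin> ord1 Q"
  define J where "J = {x \<in> carr P. f x \<in> I}"
  have img: "f ` carr P = carr Q" using f by (simp add: dposet_iso_def bij_betw_def)
  have fJ: "f ` J = I" using I img by (auto simp: J_def)
  have "J \<subseteq> carr P" by (auto simp: J_def)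
  moreover have "\<forall>x\<in>J. \<forall>y\<in>carr P - J.
      (x, y) \<in> ord2 P \<and> (x, y) \<notin> ord1 P \<and> (y, x) \<notin> ord1 P"
  proof (intro ballI)
    fix x y assume xy: "x \<in> J" "y \<in> carr P - J"
    then have mem: "x \<in> carr P" "y \<in> carr P" and "f x \<in> I" "f y \<in> carr Q - I"
      using img by (auto simp: J_def)
    then have "(f x, f y) \<in> ord2 Q \<and> (f x, f y) \<notin> ord1 Q \<and> (f y, f x) \<notin> ord1 Q"
      using sep by simp
    then show "(x, y) \<in> ord2 P \<and> (x, y) \<notin> ord1 P \<and> (y, x) \<notin> ord1 P"
      using f mem by (simp add: dposet_iso_def)
  qed
  ultimately have "J = {} \<or> J = carr P" using P by (auto simp: indecomposable1_dposet_def)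
  then show "I = {} \<or> I = carr Q" using fJ img by auto
qed

lemma indecomposable2_iso:
  assumes f: "dposet_iso f P Q" and P: "indecomposable2_dposet P"
  shows "indecomposable2_dposet Q"
  unfolding indecomposable2_dposet_def
proof (intro allI impI)
  fix I assume I: "I \<subseteq> carr Q" and
    sep: "\<forall>x\<in>I. \<forall>y\<in>carr Q - I. (x, y) \<in> ord1 Q \<and> (x, y) \<notin> ord2 Q \<and> (y, x) \<notin> ord2 Q"
  define J where "J = {x \<in> carr P. f x \<in> I}"
  have img: "f ` carr P = carr Q" using f by (simp add: dposet_iso_def bij_betw_def)
  have fJ: "f ` J = I" using I img by (auto simp: J_def)
  have "J \<subseteq> carr P" by (auto simp: J_def)
  moreover have "\<forall>x\<in>J. \<forall>y\<in>carr P - J.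
      (x, y) \<in> ord1 P \<and> (x, y) \<notin> ord2 P \<and> (y, x) \<notin> ord2 P"
  proof (intro ballI)
    fix x y assume xy: "x \<in> J" "y \<in> carr P - J"
    then have mem: "x \<in> carr P" "y \<in> carr P" and "f x \<in> I" "f y \<in> carr Q - I"
      using img by (auto simp: J_def)
    then have "(f x, f y) \<in> ord1 Q \<and> (f x, f y) \<notin> ord2 Q \<and> (f y, f x) \<notin> ord2 Q"
      using sep by simp
    then show "(x, y) \<in> ord1 P \<and> (x, y) \<notin> ord2 P \<and> (y, x) \<notin> ord2 P"
      using f mem by (simp add: dposet_iso_def)
  qed
  ultimately have "J = {} \<or> J = carr P" using P by (auto simp: indecomposable2_dposet_def)
  then show "I = {} \<or> I = carr Q" using fJ img by auto
qed

section \<open>Isomorphism classes\<close>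

definition dp_rel :: "nat dposet \<Rightarrow> nat dposet \<Rightarrow> bool" where
  "dp_rel P Q \<longleftrightarrow> double_poset P \<and> double_poset Q \<and> dposet_isomorphic P Q"

quotient_type dp = "nat dposet" / partial: dp_rel
proof (rule part_equivpI)
  show "\<exists>P. dp_rel P P"
    unfolding dp_rel_def dposet_isomorphic_def using double_poset_empty dposet_iso_refl by blast
  show "symp dp_rel"
  proof (rule sympI)
    show "dp_rel Q P" if "dp_rel P Q" for P Q
      using that dposet_iso_sym unfolding dp_rel_def dposet_isomorphic_def by blast
  qed
  show "transp dp_rel"
  proof (rule transpI)
    show "dp_rel P R" if "dp_rel P Q" "dp_rel Q R" for P Q R
      using that dposet_iso_trans unfolding dp_rel_def dposet_isomorphic_def by blast
  qed
qed

lift_definition dp_empty :: dp is empty_dposet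
  unfolding dp_rel_def dposet_isomorphic_def using double_poset_empty dposet_iso_refl by blast

text \<open>The disjoint union of two double posets on \<open>nat\<close> is moved from \<open>nat + nat\<close> back to
  \<open>nat\<close> along the bijection \<open>sum_encode\<close>.\<close>

lift_definition dp_leadsto :: "dp \<Rightarrow> dp \<Rightarrow> dp" (infixr \<open>\<leadsto>\<close> 65)
  is "\<lambda>P Q. relabel sum_encode (leadsto_dposet P Q)"
proof -
  fix P P' Q Q' :: "nat dposet"
  assume *: "dp_rel P P'" "dp_rel Q Q'"
  then have "double_poset (leadsto_dposet P Q)" "double_poset (leadsto_dposet P' Q')"
    by (simp_all add: dp_rel_def double_poset_leadsto)
  moreover have "dposet_isomorphic (leadsto_dposet P Q) (leadsto_dposet P' Q')"
    using * dposet_iso_leadsto unfolding dp_rel_def dposet_isomorphic_def by blast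
  ultimately show "dp_rel (relabel sum_encode (leadsto_dposet P Q))
      (relabel sum_encode (leadsto_dposet P' Q'))"
    by (simp add: dp_rel_def double_poset_relabel dposet_isomorphic_relabel_cong inj_sum_encode)
qed

lift_definition dp_natural :: "dp \<Rightarrow> dp \<Rightarrow> dp" (infixr \<open>\<natural>\<close> 65)
  is "\<lambda>P Q. relabel sum_encode (natural_dposet P Q)"
proof -
  fix P P' Q Q' :: "nat dposet"
  assume *: "dp_rel P P'" "dp_rel Q Q'"
  then have "double_poset (natural_dposet P Q)" "double_poset (natural_dposet P' Q')"
    by (simp_all add: dp_rel_def double_poset_natural)
  moreover have "dposet_isomorphic (natural_dposet P Q) (natural_dposet P' Q')"
    using * dposet_iso_natural unfolding dp_rel_def dposet_isomorphic_def by blast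
  ultimately show "dp_rel (relabel sum_encode (natural_dposet P Q))
      (relabel sum_encode (natural_dposet P' Q'))"
    by (simp add: dp_rel_def double_poset_relabel dposet_isomorphic_relabel_cong inj_sum_encode)
qed

lift_definition indecomposable1 :: "dp \<Rightarrow> bool" is indecomposable1_dposet
  unfolding dp_rel_def dposet_isomorphic_def
  by (blast intro: indecomposable1_iso dposet_iso_sym)

lift_definition indecomposable2 :: "dp \<Rightarrow> bool" is indecomposable2_dposet
  unfolding dp_rel_def dposet_isomorphic_def
  by (blast intro: indecomposable2_iso dposet_iso_sym)

definition indecomposable12 :: "dp \<Rightarrow> bool" where
  "indecomposable12 P \<longleftrightarrow> indecomposable1 P \<and> indecomposable2 P"

section \<open>2-As algebras\<close>

locale two_As_algebra = vector_space scale
  for scale :: "'k::field \<Rightarrow> 'a::ab_group_add \<Rightarrow> 'a" +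
  fixes m1 :: "'a \<Rightarrow> 'a \<Rightarrow> 'a"
    and m2 :: "'a \<Rightarrow> 'a \<Rightarrow> 'a"
    and unit :: 'a
  assumes m1_monoid: "monoid m1 unit"
    and m2_monoid: "monoid m2 unit"
    and m1_linear_left: "Vector_Spaces.linear scale scale (\<lambda>x. m1 x y)"
    and m1_linear_right: "Vector_Spaces.linear scale scale (\<lambda>y. m1 x y)"
    and m2_linear_left: "Vector_Spaces.linear scale scale (\<lambda>x. m2 x y)"
    and m2_linear_right: "Vector_Spaces.linear scale scale (\<lambda>y. m2 x y)"

definition two_As_hom ::
  "('k::field \<Rightarrow> 'a::ab_group_add \<Rightarrow> 'a) \<Rightarrow> ('a \<Rightarrow> 'a \<Rightarrow> 'a) \<Rightarrow> ('a \<Rightarrow> 'a \<Rightarrow> 'a) \<Rightarrow> 'a \<Rightarrow>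
   ('k \<Rightarrow> 'b::ab_group_add \<Rightarrow> 'b) \<Rightarrow> ('b \<Rightarrow> 'b \<Rightarrow> 'b) \<Rightarrow> ('b \<Rightarrow> 'b \<Rightarrow> 'b) \<Rightarrow> 'b \<Rightarrow>
   ('a \<Rightarrow> 'b) \<Rightarrow> bool" where
  "two_As_hom scaleA mA1 mA2 unitA scaleB mB1 mB2 unitB \<phi> \<longleftrightarrow>
     Vector_Spaces.linear scaleA scaleB \<phi> \<and>
     (\<forall>x y. \<phi> (mA1 x y) = mB1 (\<phi> x) (\<phi> y)) \<and>
     (\<forall>x y. \<phi> (mA2 x y) = mB2 (\<phi> x) (\<phi> y)) \<and>
     \<phi> unitA = unitB"

section \<open>The algebra of double posets\<close>

text \<open>\<open>dp \<Rightarrow>\<^sub>0 'k\<close> is the vector space with basis \<open>dp\<close>. The products below are not the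
  convolution product that \<open>Poly_Mapping\<close> provides for index types with an addition.\<close>

definition H_basis :: "dp \<Rightarrow> (dp \<Rightarrow>\<^sub>0 'k::field)" where
  "H_basis P = Poly_Mapping.single P 1"

definition H_scale :: "'k::field \<Rightarrow> (dp \<Rightarrow>\<^sub>0 'k) \<Rightarrow> (dp \<Rightarrow>\<^sub>0 'k)" where
  "H_scale c u = Poly_Mapping.map ((*) c) u"

definition bilinear_extension ::
  "(dp \<Rightarrow> dp \<Rightarrow> dp) \<Rightarrow> (dp \<Rightarrow>\<^sub>0 'k::field) \<Rightarrow> (dp \<Rightarrow>\<^sub>0 'k) \<Rightarrow> (dp \<Rightarrow>\<^sub>0 'k)" where
  "bilinear_extension m u v =
     (\<Sum>P\<in>Poly_Mapping.keys u. \<Sum>Q\<in>Poly_Mapping.keys v.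
        H_scale (Poly_Mapping.lookup u P * Poly_Mapping.lookup v Q) (H_basis (m P Q)))"

definition H_leadsto :: "(dp \<Rightarrow>\<^sub>0 'k::field) \<Rightarrow> (dp \<Rightarrow>\<^sub>0 'k) \<Rightarrow> (dp \<Rightarrow>\<^sub>0 'k)" where
  "H_leadsto = bilinear_extension (\<leadsto>)"

definition H_natural :: "(dp \<Rightarrow>\<^sub>0 'k::field) \<Rightarrow> (dp \<Rightarrow>\<^sub>0 'k) \<Rightarrow> (dp \<Rightarrow>\<^sub>0 'k)" where
  "H_natural = bilinear_extension (\<natural>)"

definition H_unit :: "dp \<Rightarrow>\<^sub>0 'k::field" where
  "H_unit = H_basis dp_empty"

end

theory Submission
  imports Defs
begin

text \<open>
  The theorem is a statement about the set of isomorphism classes alone: under each of the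
  two products the classes form a free monoid, and the two free monoids interact in the
  most generic way. Linear extension then turns this into a statement about algebras.

  A factorisation \<open>P = Q \<leadsto> R\<close> is the same thing as a cut of \<open>P\<close>, that is, a subset \<open>I\<close> such
  that every element of \<open>I\<close> is below every element outside \<open>I\<close> for the second order and
  incomparable to it for the first one. The second order is antisymmetric, so two cuts of
  the same double poset are always nested (\<open>cut_chain\<close>). Nested cuts give a common
  refinement of any two factorisations, which is Levi's lemma (\<open>leadsto_levi\<close>). Levi's lemma
  together with the additive number of elements makes the monoid for \<open>\<leadsto>\<close> free: every nonempty
  class has exactly one first indecomposable factor. Exchanging the two orders carries all of
  this over to \<open>\<natural>\<close>.

  The two products are independent because no class is a proper product for both
  (\<open>leadsto_natural_disjoint\<close>): two elements separated by a cut for \<open>\<leadsto>\<close> are incomparable for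
  the first order, and two elements separated by a cut for \<open>\<natural>\<close> are comparable for it, so no
  pair is separated by both cuts. Given proper cuts of both kinds, two elements on different
  sides of the first would lie on the same side of the second, and hence so would all elements.

  Consequently a nonempty class is either indecomposable for both products or a proper product
  for exactly one of them. The morphism on basis elements is defined by recursion on the number
  of elements: it multiplies the values on the first indecomposable factor and on the rest,
  with the product of \<open>A\<close> that corresponds to the decomposition. Uniqueness of the first
  factor and associativity in \<open>A\<close> make it multiplicative (\<open>multiplicative_if_on_atoms\<close>). Any
  morphism agrees with it, because the indecomposable classes generate the others
  (\<open>generated_induct\<close>).
\<close>

section \<open>Monoids with Levi's refinement property\<close>

text \<open>These hypotheses characterise free monoids with a positive integral weight on the
  generators (Levi's lemma says that two factorisations have a common refinement). Only the
  consequences needed for a universal property are derived, in terms of the first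
  generator of a word and the rest.\<close>

locale levi_monoid = monoid mult one
  for mult :: "'a \<Rightarrow> 'a \<Rightarrow> 'a" (infixr \<open>\<cdot>\<close> 70) and one :: 'a +
  fixes size :: "'a \<Rightarrow> nat"
  assumes size_mult: "size (x \<cdot> y) = size x + size y"
    and size_eq_0: "size x = 0 \<longleftrightarrow> x = one"
    and levi: "x \<cdot> y = x' \<cdot> y' \<Longrightarrow>
      \<exists>z. (x' = x \<cdot> z \<and> y = z \<cdot> y') \<or> (x = x' \<cdot> z \<and> y' = z \<cdot> y)"
begin

definition atom :: "'a \<Rightarrow> bool" where
  "atom p \<longleftrightarrow> p \<noteq> one \<and> (\<forall>x y. p = x \<cdot> y \<longrightarrow> x = one \<or> y = one)"

lemma size_pos: "0 < size x \<longleftrightarrow> x \<noteq> one"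
  using size_eq_0[of x] by auto

lemma mult_eq_one: "x \<cdot> y = one \<longleftrightarrow> x = one \<and> y = one"
  by (metis add_is_0 size_eq_0 size_mult)

lemma ex_atom_factor: "x \<noteq> one \<Longrightarrow> \<exists>p y. atom p \<and> x = p \<cdot> y"
proof (induction "size x" arbitrary: x rule: less_induct)
  case less
  show ?case
  proof (cases "atom x")
    case True
    then show ?thesis by (metis right_neutral)
  next
    case False
    then obtain u v where uv: "x = u \<cdot> v" "u \<noteq> one" "v \<noteq> one"
      using less.prems unfolding atom_def by blast
    then have "size u < size x" by (simp add: size_mult size_pos)
    with less.hyps uv obtain p y where "atom p" "u = p \<cdot> y" by blast
    then show ?thesis using uv by (auto simp: assoc)
  qed
qed

text \<open>By Levi's lemma one of the atoms is a left factor of the other, and an atom has no proper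
  factor.\<close>

lemma atom_factor_unique:
  assumes "atom p" "atom q" "p \<cdot> y = q \<cdot> z"
  shows "p = q \<and> y = z"
  using levi[OF assms(3)] assms(1,2) unfolding atom_def by (metis left_neutral right_neutral)

definition atom_split :: "'a \<Rightarrow> 'a \<times> 'a" where
  "atom_split x = (SOME (p, y). atom p \<and> x = p \<cdot> y)"

lemma atom_split_mult: "atom p \<Longrightarrow> atom_split (p \<cdot> y) = (p, y)"
  unfolding atom_split_def by (rule some_equality) (auto dest: atom_factor_unique)

lemma atom_splitE:
  assumes "x \<noteq> one"
  obtains p y where "atom_split x = (p, y)" "atom p" "x = p \<cdot> y"
  using ex_atom_factor[OF assms] atom_split_mult by metis

lemma atom_split_size:
  assumes "x \<noteq> one" "\<not> atom x"
  shows "size (fst (atom_split x)) < size x" "size (snd (atom_split x)) < size x"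
proof -
  obtain p y where py: "atom_split x = (p, y)" "atom p" "x = p \<cdot> y"
    using assms(1) by (rule atom_splitE)
  have "p \<noteq> one" using py(2) by (simp add: atom_def)
  moreover have "y \<noteq> one" using py(2,3) assms(2) by (metis right_neutral)
  ultimately show "size (fst (atom_split x)) < size x" "size (snd (atom_split x)) < size x"
    using py by (simp_all add: size_mult size_pos)
qed

text \<open>Peeling off the first atom of \<open>x\<close> reduces multiplicativity to the case in which the left
  factor is an atom. The case \<open>y = one\<close> is excluded from the hypothesis since \<open>p \<cdot> one\<close> is an
  atom, on which a recursively defined \<open>f\<close> takes a prescribed value.\<close>

lemma multiplicative_if_on_atoms:
  assumes m: "monoid m e"
    and one: "f one = e"
    and atom: "\<And>p y. atom p \<Longrightarrow> y \<noteq> one \<Longrightarrow> f (p \<cdot> y) = m (f p) (f y)"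
  shows "f (x \<cdot> y) = m (f x) (f y)"
proof -
  interpret m: monoid m e by (rule m)
  have atom': "f (p \<cdot> y) = m (f p) (f y)" if "atom p" for p y
    using atom[OF that] one by (cases "y = one") auto
  show ?thesis
  proof (induction "size x" arbitrary: x rule: less_induct)
    case less
    show ?case
    proof (cases "x = one")
      case True
      then show ?thesis using one by simp
    next
      case False
      then obtain p z where pz: "atom p" "x = p \<cdot> z" using ex_atom_factor by blast
      then have "p \<noteq> one" by (simp add: atom_def)
      then have "size z < size x" using pz size_mult[of p z] size_eq_0[of p] by simp
      then have "f (z \<cdot> y) = m (f z) (f y)" by (rule less.hyps)
      then show ?thesis using pz by (simp add: assoc atom' m.assoc)
    qed
  qed
qed

end

section \<open>Two products without common decompositions\<close>

text \<open>The last hypothesis makes the two free structures independent: every element other than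
  the unit is an atom for at least one of the products.\<close>

locale double_levi_monoid =
  L1: levi_monoid mult1 one size + L2: levi_monoid mult2 one size
  for mult1 :: "'a \<Rightarrow> 'a \<Rightarrow> 'a" (infixr \<open>\<cdot>\<^sub>1\<close> 70)
    and mult2 :: "'a \<Rightarrow> 'a \<Rightarrow> 'a" (infixr \<open>\<cdot>\<^sub>2\<close> 70)
    and one :: 'a and size :: "'a \<Rightarrow> nat" +
  assumes disjoint: "x \<cdot>\<^sub>1 y = u \<cdot>\<^sub>2 v \<Longrightarrow> x = one \<or> y = one \<or> u = one \<or> v = one"
begin

lemma generated_induct [case_names one atom mult1 mult2]:
  assumes one: "Q one"
    and atom: "\<And>p. L1.atom p \<Longrightarrow> L2.atom p \<Longrightarrow> Q p"
    and mult1: "\<And>x y. Q x \<Longrightarrow> Q y \<Longrightarrow> Q (x \<cdot>\<^sub>1 y)"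
    and mult2: "\<And>x y. Q x \<Longrightarrow> Q y \<Longrightarrow> Q (x \<cdot>\<^sub>2 y)"
  shows "Q x"
proof (induction "size x" arbitrary: x rule: less_induct)
  case less
  consider "x = one" | "L1.atom x" "L2.atom x"
    | u v where "x = u \<cdot>\<^sub>1 v" "u \<noteq> one" "v \<noteq> one"
    | u v where "x = u \<cdot>\<^sub>2 v" "u \<noteq> one" "v \<noteq> one"
    unfolding L1.atom_def L2.atom_def by blast
  then show ?case
  proof cases
    case (3 u v)
    then show ?thesis
      using mult1 less.hyps[of u] less.hyps[of v] L1.size_mult[of u v] L1.size_pos by simp
  next
    case (4 u v)
    then show ?thesis
      using mult2 less.hyps[of u] less.hyps[of v] L2.size_mult[of u v] L1.size_pos by simp
  qed (use one atom in auto)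
qed

text \<open>The extension to all elements of a family \<open>a\<close> given on the common atoms. In the last
  branch \<open>x\<close> is an atom for \<open>mult1\<close> and hence decomposes for \<open>mult2\<close>; by disjointness the
  order in which the two products are tried does not affect the value.\<close>

function evaluate :: "('b \<Rightarrow> 'b \<Rightarrow> 'b) \<Rightarrow> ('b \<Rightarrow> 'b \<Rightarrow> 'b) \<Rightarrow> 'b \<Rightarrow> ('a \<Rightarrow> 'b) \<Rightarrow> 'a \<Rightarrow> 'b" where
  "evaluate m1 m2 e a x =
     (if x = one then e
      else if L1.atom x \<and> L2.atom x then a x
      else if \<not> L1.atom x then
        m1 (evaluate m1 m2 e a (fst (L1.atom_split x))) (evaluate m1 m2 e a (snd (L1.atom_split x)))
      else
        m2 (evaluate m1 m2 e a (fst (L2.atom_split x))) (evaluate m1 m2 e a (snd (L2.atom_split x))))"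
  by pat_completeness auto

termination evaluate
  by (relation "measure (\<lambda>(m1, m2, e, a, x). size x)")
    (use L1.atom_split_size L2.atom_split_size in auto)

declare evaluate.simps [simp del]

lemma evaluate_one: "evaluate m1 m2 e a one = e"
  by (simp add: evaluate.simps)

lemma evaluate_atom: "L1.atom p \<Longrightarrow> L2.atom p \<Longrightarrow> evaluate m1 m2 e a p = a p"
  by (simp add: evaluate.simps L1.atom_def)

lemma evaluate_mult1:
  assumes "monoid m1 e"
  shows "evaluate m1 m2 e a (x \<cdot>\<^sub>1 y) = m1 (evaluate m1 m2 e a x) (evaluate m1 m2 e a y)"
proof (rule L1.multiplicative_if_on_atoms[where f = "evaluate m1 m2 e a", OF assms evaluate_one])
  fix p y assume p: "L1.atom p" and y: "y \<noteq> one"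
  have "p \<noteq> one" using p by (simp add: L1.atom_def)
  then have "\<not> L1.atom (p \<cdot>\<^sub>1 y)" "p \<cdot>\<^sub>1 y \<noteq> one"
    using y by (auto simp: L1.atom_def L1.mult_eq_one)
  then show "evaluate m1 m2 e a (p \<cdot>\<^sub>1 y) = m1 (evaluate m1 m2 e a p) (evaluate m1 m2 e a y)"
    by (subst evaluate.simps) (simp add: L1.atom_split_mult[OF p])
qed

lemma evaluate_mult2:
  assumes "monoid m2 e"
  shows "evaluate m1 m2 e a (x \<cdot>\<^sub>2 y) = m2 (evaluate m1 m2 e a x) (evaluate m1 m2 e a y)"
proof (rule L2.multiplicative_if_on_atoms[where f = "evaluate m1 m2 e a", OF assms evaluate_one])
  fix p y assume p: "L2.atom p" and y: "y \<noteq> one"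
  have "p \<noteq> one" using p by (simp add: L2.atom_def)
  then have "\<not> L2.atom (p \<cdot>\<^sub>2 y)" "p \<cdot>\<^sub>2 y \<noteq> one" "L1.atom (p \<cdot>\<^sub>2 y)"
    using y disjoint[of _ _ p y] by (auto simp: L1.atom_def L2.atom_def L2.mult_eq_one)
  then show "evaluate m1 m2 e a (p \<cdot>\<^sub>2 y) = m2 (evaluate m1 m2 e a p) (evaluate m1 m2 e a y)"
    by (subst evaluate.simps) (simp add: L2.atom_split_mult[OF p])
qed

end

section \<open>Cuts of double posets\<close>

definition subposet :: "'a dposet \<Rightarrow> 'a set \<Rightarrow> 'a dposet" where
  "subposet X A =
     \<lparr>carr = carr X \<inter> A, ord1 = ord1 X \<inter> A \<times> A, ord2 = ord2 X \<inter> A \<times> A\<rparr>"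

text \<open>Cuts are exactly the left factors of factorisations for \<open>\<leadsto>\<close>, realised inside the double
  poset itself. Working with them avoids nested sum types: associativity, unit
  laws and refinement all become statements about subsets of one carrier.\<close>

definition leadsto_cut :: "'a dposet \<Rightarrow> 'a set \<Rightarrow> bool" where
  "leadsto_cut X I \<longleftrightarrow> I \<subseteq> carr X \<and>
     (\<forall>x\<in>I. \<forall>y\<in>carr X - I. (x, y) \<in> ord2 X \<and> (x, y) \<notin> ord1 X \<and> (y, x) \<notin> ord1 X)"

lemma carr_subposet [simp]: "carr (subposet X A) = carr X \<inter> A"
  by (simp add: subposet_def)

lemma double_poset_subposet: "double_poset X \<Longrightarrow> double_poset (subposet X A)"
  unfolding double_poset_def partial_order_on_iff by (simp add: subposet_def) blast

lemma subposet_subposet: "subposet (subposet X A) B = subposet X (A \<inter> B)"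
  by (auto simp: subposet_def)

lemma subposet_carr: "double_poset X \<Longrightarrow> carr X \<subseteq> A \<Longrightarrow> subposet X A = X"
  unfolding double_poset_def partial_order_on_iff
  by (intro dposet.equality) (auto simp: subposet_def)

lemma cut_subposet: "leadsto_cut X I \<Longrightarrow> leadsto_cut (subposet X A) (I \<inter> A)"
  by (auto simp: leadsto_cut_def subposet_def)

lemma cut_trans:
  assumes "leadsto_cut X J" "leadsto_cut (subposet X J) I"
  shows "leadsto_cut X I"
  unfolding leadsto_cut_def
proof (intro conjI ballI)
  have sub: "I \<subseteq> carr X \<inter> J" using assms(2) by (simp add: leadsto_cut_def)
  then show "I \<subseteq> carr X" by blast
  fix x y assume xy: "x \<in> I" "y \<in> carr X - I"
  have "(x, y) \<in> ord2 X \<and> (x, y) \<notin> ord1 X \<and> (y, x) \<notin> ord1 X"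
  proof (cases "y \<in> J")
    case True
    with xy sub have "x \<in> J" "y \<in> carr (subposet X J) - I" by auto
    with xy(1) assms(2) have "(x, y) \<in> ord2 (subposet X J) \<and>
        (x, y) \<notin> ord1 (subposet X J) \<and> (y, x) \<notin> ord1 (subposet X J)"
      unfolding leadsto_cut_def by blast
    with \<open>x \<in> J\<close> True show ?thesis by (simp add: subposet_def)
  next
    case False
    with xy sub have "x \<in> J" "y \<in> carr X - J" by blast+
    with assms(1) show ?thesis unfolding leadsto_cut_def by blast
  qed
  then show "(x, y) \<in> ord2 X" "(x, y) \<notin> ord1 X" "(y, x) \<notin> ord1 X" by auto
qed

lemma indecomposable1_dposet_iff_cut:
  "indecomposable1_dposet X \<longleftrightarrow> (\<forall>I. leadsto_cut X I \<longrightarrow> I = {} \<or> I = carr X)"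
  unfolding indecomposable1_dposet_def leadsto_cut_def by blast

text \<open>An element of \<open>I - J\<close> and one of \<open>J - I\<close> would each be below the other for the second order,
  contrary to antisymmetry.\<close>

lemma cut_chain:
  assumes "double_poset X" "leadsto_cut X I" "leadsto_cut X J"
  shows "I \<subseteq> J \<or> J \<subseteq> I"
proof (rule ccontr)
  assume "\<not> (I \<subseteq> J \<or> J \<subseteq> I)"
  then obtain x y where "x \<in> I - J" "y \<in> J - I" by blast
  moreover from this have "(x, y) \<in> ord2 X" "(y, x) \<in> ord2 X"
    using assms(2,3) by (auto simp: leadsto_cut_def)
  ultimately show False
    using assms(1) unfolding double_poset_def partial_order_on_iff by blast
qed

lemma cut_iso_leadsto:
  assumes "double_poset X" "leadsto_cut X I"
  shows "dposet_iso (\<lambda>x. if x \<in> I then Inl x else Inr x)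
    X (leadsto_dposet (subposet X I) (subposet X (- I)))"
proof -
  have "bij_betw (\<lambda>x. if x \<in> I then Inl x else Inr x) (carr X)
      ((carr X \<inter> I) <+> (carr X \<inter> - I))"
    by (rule bij_betw_byWitness[where f' = "case_sum id id"]) (auto simp: Plus_def)
  moreover have "(y, x) \<notin> ord2 X" if "x \<in> I" "y \<in> carr X - I" for x y
    using assms that unfolding leadsto_cut_def double_poset_def partial_order_on_iff by blast
  ultimately show ?thesis
    using assms(2)
    by (auto simp: dposet_iso_def leadsto_dposet_def subposet_def leadsto_cut_def)
qed

text \<open>The image of the left summand under any identification with a disjoint union is a cut, so
  cuts account for every factorisation.\<close>

lemma iso_leadsto_cut:
  assumes h: "dposet_iso h (leadsto_dposet P Q) X"
  defines "I \<equiv> h ` Inl ` carr P"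
  shows "leadsto_cut X I" "dposet_iso (h \<circ> Inl) P (subposet X I)"
    "dposet_iso (h \<circ> Inr) Q (subposet X (- I))"
proof -
  have inj: "inj_on h (carr P <+> carr Q)" and im: "h ` (carr P <+> carr Q) = carr X"
    using h by (auto simp: dposet_iso_def bij_betw_def leadsto_dposet_def)
  have X: "carr X = I \<union> h ` Inr ` carr Q"
    using im by (simp add: I_def Plus_def image_Un)
  have disj: "h (Inr y) \<notin> I" if "y \<in> carr Q" for y
    using that inj by (auto simp: I_def dest!: inj_onD)
  then have X': "carr X - I = h ` Inr ` carr Q" "carr X \<inter> - I = h ` Inr ` carr Q"
    "carr X \<inter> I = I"
    using X by auto
  have "(h (Inl x), h (Inr y)) \<in> ord2 X \<and> (h (Inl x), h (Inr y)) \<notin> ord1 X \<and>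
      (h (Inr y), h (Inl x)) \<notin> ord1 X" if "x \<in> carr P" "y \<in> carr Q" for x y
    using h that unfolding dposet_iso_def leadsto_dposet_def
    by (simp add: Plus_def ball_Un)
  then show "leadsto_cut X I"
    unfolding leadsto_cut_def X'(1) using X by (auto simp: I_def)
  have "inj_on (h \<circ> Inl) (carr P)" "inj_on (h \<circ> Inr) (carr Q)"
    using inj by (auto simp: inj_on_def)
  then have bij: "bij_betw (h \<circ> Inl) (carr P) I" "bij_betw (h \<circ> Inr) (carr Q) (h ` Inr ` carr Q)"
    by (auto simp: bij_betw_def I_def image_comp)
  show "dposet_iso (h \<circ> Inl) P (subposet X I)"
    using h bij(1) unfolding dposet_iso_def leadsto_dposet_def
    by (simp add: X' subposet_def Plus_def ball_Un) (simp add: I_def)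
  show "dposet_iso (h \<circ> Inr) Q (subposet X (- I))"
    using h bij(2) unfolding dposet_iso_def leadsto_dposet_def
    by (simp add: X' subposet_def Plus_def ball_Un) (simp add: disj)
qed

section \<open>Cuts and decompositions of isomorphism classes\<close>

lemma dp_rel_refl: "double_poset X \<Longrightarrow> dp_rel X X"
  using dposet_iso_refl unfolding dp_rel_def dposet_isomorphic_def by blast

lemma abs_dp_eq_iff:
  assumes "double_poset X" "double_poset Y"
  shows "abs_dp X = abs_dp Y \<longleftrightarrow> dposet_isomorphic X Y"
  using Quotient_rel[OF Quotient_dp, of X Y] assms dp_rel_refl by (auto simp: dp_rel_def)

lemma dp_cases:
  obtains X where "double_poset X" "P = abs_dp X"
  by (metis Quotient_abs_rep[OF Quotient_dp] Quotient_rep_reflp[OF Quotient_dp] dp_rel_def)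

text \<open>Trades the product on classes, which relabels the sum type by natural numbers, for an
  isomorphism with the disjoint union itself.\<close>

lemma abs_dp_leadsto_iff:
  assumes "double_poset P" "double_poset Q" "double_poset X"
  shows "abs_dp P \<leadsto> abs_dp Q = abs_dp X \<longleftrightarrow> dposet_isomorphic (leadsto_dposet P Q) X"
proof -
  let ?S = "leadsto_dposet P Q"
  have S: "double_poset ?S" using assms double_poset_leadsto by blast
  have "abs_dp P \<leadsto> abs_dp Q = abs_dp (relabel sum_encode ?S)"
    using assms by (simp add: dp_leadsto.abs_eq dp_rel_refl)
  moreover have "double_poset (relabel sum_encode ?S)"
    by (rule double_poset_relabel[OF S inj_sum_encode])
  moreover note iso = dposet_iso_relabel[OF S inj_sum_encode]
  have "dposet_isomorphic (relabel sum_encode ?S) X \<longleftrightarrow> dposet_isomorphic ?S X"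
    unfolding dposet_isomorphic_def
    using dposet_iso_trans[OF iso] dposet_iso_trans[OF dposet_iso_sym[OF iso]] by blast
  ultimately show ?thesis using assms by (simp add: abs_dp_eq_iff)
qed

lemma abs_dp_cut:
  assumes "double_poset X" "leadsto_cut X I"
  shows "abs_dp X = abs_dp (subposet X I) \<leadsto> abs_dp (subposet X (- I))"
  using dposet_iso_sym[OF cut_iso_leadsto[OF assms]] assms(1)
    abs_dp_leadsto_iff[of "subposet X I" "subposet X (- I)" X]
  unfolding dposet_isomorphic_def by (metis double_poset_subposet)

lemma leadsto_cutE:
  assumes "double_poset X" "abs_dp X = P \<leadsto> Q"
  obtains I where "leadsto_cut X I" "P = abs_dp (subposet X I)" "Q = abs_dp (subposet X (- I))"
proof -
  obtain P' Q' where P': "double_poset P'" "P = abs_dp P'" and Q': "double_poset Q'" "Q = abs_dp Q'"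
    using dp_cases by metis
  then obtain h where "dposet_iso h (leadsto_dposet P' Q') X"
    using abs_dp_leadsto_iff assms unfolding dposet_isomorphic_def by metis
  from iso_leadsto_cut[OF this] show ?thesis
    using that P' Q' abs_dp_eq_iff double_poset_subposet assms(1)
    unfolding dposet_isomorphic_def by metis
qed

lift_definition dp_size :: "dp \<Rightarrow> nat" is "\<lambda>P. card (carr P)"
  unfolding dp_rel_def dposet_isomorphic_def dposet_iso_def by (auto dest: bij_betw_same_card)

lemma dp_size_abs: "double_poset X \<Longrightarrow> dp_size (abs_dp X) = card (carr X)"
  by (simp add: dp_size.abs_eq dp_rel_refl)

lemma abs_dp_eq_empty_iff:
  assumes "double_poset X"
  shows "abs_dp X = dp_empty \<longleftrightarrow> carr X = {}"
proof -
  have "dposet_isomorphic X (empty_dposet :: nat dposet) \<longleftrightarrow> carr X = {}"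
    by (auto simp: dposet_isomorphic_def dposet_iso_def empty_dposet_def bij_betw_def)
  then show ?thesis
    using abs_dp_eq_iff[OF assms double_poset_empty] by (simp add: dp_empty_def)
qed

lemma dp_size_eq_0: "dp_size P = 0 \<longleftrightarrow> P = dp_empty"
proof -
  obtain X where "double_poset X" "P = abs_dp X" by (rule dp_cases)
  then show ?thesis
    by (simp add: dp_size_abs abs_dp_eq_empty_iff) (simp add: double_poset_def)
qed

text \<open>A nested pair of cuts splits the double poset into the three blocks \<open>I\<close>, \<open>J - I\<close> and
  \<open>- J\<close>. The middle block is the common refinement in Levi's lemma, and it is the middle factor
  in the associative law.\<close>

lemma abs_dp_cut_nested:
  assumes X: "double_poset X" and "leadsto_cut X I" "leadsto_cut X J" "I \<subseteq> J"
  shows "abs_dp (subposet X J) = abs_dp (subposet X I) \<leadsto> abs_dp (subposet X (J - I))"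
    and "abs_dp (subposet X (- I)) = abs_dp (subposet X (J - I)) \<leadsto> abs_dp (subposet X (- J))"
proof -
  have "J \<inter> I = I" "J \<inter> - I = J - I" "I \<inter> J = I" using assms by auto
  then show "abs_dp (subposet X J) = abs_dp (subposet X I) \<leadsto> abs_dp (subposet X (J - I))"
    using abs_dp_cut[OF double_poset_subposet[OF X] cut_subposet[OF assms(2), of J]]
    by (simp add: subposet_subposet)
  have "- I \<inter> (J \<inter> - I) = J - I" "- I \<inter> - (J \<inter> - I) = - J" using assms by auto
  then show "abs_dp (subposet X (- I)) =
      abs_dp (subposet X (J - I)) \<leadsto> abs_dp (subposet X (- J))"
    using abs_dp_cut[OF double_poset_subposet[OF X] cut_subposet[OF assms(3), of "- I"]]
    by (simp add: subposet_subposet)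
qed

text \<open>The two factorisations are two cuts of one double poset, and these are nested.\<close>

lemma leadsto_levi:
  assumes "P \<leadsto> Q = P' \<leadsto> Q'"
  shows "\<exists>R. (P' = P \<leadsto> R \<and> Q = R \<leadsto> Q') \<or> (P = P' \<leadsto> R \<and> Q' = R \<leadsto> Q)"
proof -
  obtain X where X: "double_poset X" "P \<leadsto> Q = abs_dp X" by (rule dp_cases)
  obtain I where I: "leadsto_cut X I" "P = abs_dp (subposet X I)" "Q = abs_dp (subposet X (- I))"
    using X by (metis leadsto_cutE)
  obtain J where J: "leadsto_cut X J" "P' = abs_dp (subposet X J)" "Q' = abs_dp (subposet X (- J))"
    using X assms by (metis leadsto_cutE)
  show ?thesis
    using cut_chain[OF X(1) I(1) J(1)] abs_dp_cut_nested[OF X(1)] I J by metis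
qed

lemma leadsto_assoc: "(P \<leadsto> Q) \<leadsto> R = P \<leadsto> Q \<leadsto> R"
proof -
  obtain X where X: "double_poset X" "(P \<leadsto> Q) \<leadsto> R = abs_dp X" by (rule dp_cases)
  obtain J where J: "leadsto_cut X J" "P \<leadsto> Q = abs_dp (subposet X J)" "R = abs_dp (subposet X (- J))"
    using X by (metis leadsto_cutE)
  obtain I where I: "leadsto_cut (subposet X J) I" "P = abs_dp (subposet (subposet X J) I)"
      "Q = abs_dp (subposet (subposet X J) (- I))"
    using J X by (metis leadsto_cutE double_poset_subposet)
  have IJ: "I \<subseteq> J" using I(1) by (auto simp: leadsto_cut_def)
  then have "J \<inter> I = I" "J \<inter> - I = J - I" by auto
  then have PQ: "P = abs_dp (subposet X I)" "Q = abs_dp (subposet X (J - I))"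
    using I by (simp_all add: subposet_subposet)
  have cI: "leadsto_cut X I" using cut_trans J(1) I(1) .
  have "(P \<leadsto> Q) \<leadsto> R = abs_dp (subposet X I) \<leadsto> abs_dp (subposet X (- I))"
    unfolding X(2) by (rule abs_dp_cut[OF X(1) cI])
  also have "\<dots> = P \<leadsto> Q \<leadsto> R"
    unfolding abs_dp_cut_nested(2)[OF X(1) cI J(1) IJ] PQ J(3) ..
  finally show ?thesis .
qed

lemma leadsto_monoid: "monoid (\<leadsto>) dp_empty"
proof
  fix P Q R
  show "(P \<leadsto> Q) \<leadsto> R = P \<leadsto> Q \<leadsto> R" by (rule leadsto_assoc)
  obtain X where X: "double_poset X" "P = abs_dp X" by (rule dp_cases)
  have cuts: "leadsto_cut X {}" "leadsto_cut X (carr X)" by (auto simp: leadsto_cut_def)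
  have empty: "abs_dp (subposet X {}) = dp_empty" "abs_dp (subposet X (- carr X)) = dp_empty"
    using X by (simp_all add: abs_dp_eq_empty_iff double_poset_subposet)
  show "dp_empty \<leadsto> P = P"
    using abs_dp_cut[OF X(1) cuts(1), symmetric] unfolding empty X(2) by (simp add: subposet_carr X(1))
  show "P \<leadsto> dp_empty = P"
    using abs_dp_cut[OF X(1) cuts(2), symmetric] unfolding empty X(2) by (simp add: subposet_carr X(1))
qed

lemma dp_size_leadsto: "dp_size (P \<leadsto> Q) = dp_size P + dp_size Q"
proof -
  obtain X where X: "double_poset X" "P \<leadsto> Q = abs_dp X" by (rule dp_cases)
  obtain I where I: "leadsto_cut X I" "P = abs_dp (subposet X I)" "Q = abs_dp (subposet X (- I))"
    using X by (metis leadsto_cutE)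
  have "finite (carr X)" using X(1) by (simp add: double_poset_def)
  then have "card (carr X) = card (carr X \<inter> I) + card (carr X \<inter> - I)"
    by (metis card_Int_Diff Diff_eq)
  then show ?thesis using X I by (simp add: dp_size_abs double_poset_subposet)
qed

interpretation leadsto: levi_monoid "(\<leadsto>)" dp_empty dp_size
  by (intro levi_monoid.intro levi_monoid_axioms.intro)
    (fact leadsto_monoid leadsto_levi dp_size_leadsto dp_size_eq_0)+

lemma leadsto_atom_iff: "leadsto.atom P \<longleftrightarrow> P \<noteq> dp_empty \<and> indecomposable1 P"
proof -
  obtain X where X: "double_poset X" "P = abs_dp X" by (rule dp_cases)
  have ind: "indecomposable1 P \<longleftrightarrow> (\<forall>I. leadsto_cut X I \<longrightarrow> I = {} \<or> I = carr X)"
    using X by (simp add: indecomposable1.abs_eq dp_rel_refl indecomposable1_dposet_iff_cut)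
  have empty: "abs_dp (subposet X I) = dp_empty \<longleftrightarrow> I = {}"
    "abs_dp (subposet X (- I)) = dp_empty \<longleftrightarrow> I = carr X" if "leadsto_cut X I" for I
    using that X(1) by (auto simp: abs_dp_eq_empty_iff double_poset_subposet leadsto_cut_def)
  have "(\<forall>Q R. P = Q \<leadsto> R \<longrightarrow> Q = dp_empty \<or> R = dp_empty) \<longleftrightarrow>
      (\<forall>I. leadsto_cut X I \<longrightarrow> I = {} \<or> I = carr X)"
    (is "?no_factor \<longleftrightarrow> ?no_cut")
  proof
    show ?no_cut if ?no_factor
      using that abs_dp_cut[OF X(1)] empty unfolding X(2) by blast
    show ?no_factor if no_cut: ?no_cut
    proof (intro allI impI)
      fix Q R assume "P = Q \<leadsto> R"
      then obtain I where "leadsto_cut X I"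
        "Q = abs_dp (subposet X I)" "R = abs_dp (subposet X (- I))"
        using X by (metis leadsto_cutE)
      with no_cut empty show "Q = dp_empty \<or> R = dp_empty" by blast
    qed
  qed
  then show ?thesis using ind by (simp add: leadsto.atom_def)
qed

section \<open>Exchanging the two orders\<close>

text \<open>Exchanging the orders is an involution that turns \<open>\<natural>\<close> into \<open>\<leadsto>\<close>, so that every property
  of \<open>\<natural>\<close> follows from the corresponding one of \<open>\<leadsto>\<close>.\<close>

definition swap_dposet :: "'a dposet \<Rightarrow> 'a dposet" where
  "swap_dposet X = \<lparr>carr = carr X, ord1 = ord2 X, ord2 = ord1 X\<rparr>"

lemma swap_swap_dposet [simp]: "swap_dposet (swap_dposet X) = X"
  by (simp add: swap_dposet_def)

lemma double_poset_swap [simp]: "double_poset (swap_dposet X) = double_poset X"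
  by (auto simp: swap_dposet_def double_poset_def)

lift_definition dp_swap :: "dp \<Rightarrow> dp" is swap_dposet
  by (auto simp: dp_rel_def dposet_isomorphic_def dposet_iso_def)
    (auto simp: swap_dposet_def)

lemma dp_swap_abs: "double_poset X \<Longrightarrow> dp_swap (abs_dp X) = abs_dp (swap_dposet X)"
  by (simp add: dp_swap.abs_eq dp_rel_refl)

lemma dp_swap_swap [simp]: "dp_swap (dp_swap P) = P"
  by (metis dp_cases double_poset_swap dp_swap_abs swap_swap_dposet)

lemma dp_swap_eq_iff: "dp_swap P = Q \<longleftrightarrow> P = dp_swap Q"
  by auto

lemma dp_size_swap [simp]: "dp_size (dp_swap P) = dp_size P"
proof -
  obtain X where "double_poset X" "P = abs_dp X" by (rule dp_cases)
  then show ?thesis by (simp add: dp_swap_abs dp_size_abs) (simp add: swap_dposet_def)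
qed

lemma dp_swap_empty [simp]: "dp_swap dp_empty = dp_empty"
  by (metis dp_size_swap dp_size_eq_0)

lemma natural_eq_swap: "P \<natural> Q = dp_swap (dp_swap P \<leadsto> dp_swap Q)"
proof -
  obtain X Y where X: "double_poset X" "P = abs_dp X" and Y: "double_poset Y" "Q = abs_dp Y"
    using dp_cases by metis
  have "relabel sum_encode (natural_dposet X Y) =
      swap_dposet (relabel sum_encode (leadsto_dposet (swap_dposet X) (swap_dposet Y)))"
    by (simp add: swap_dposet_def relabel_def natural_dposet_def leadsto_dposet_def)
  moreover have "double_poset (relabel sum_encode
      (leadsto_dposet (swap_dposet X) (swap_dposet Y)))"
    using X Y by (intro double_poset_relabel double_poset_leadsto inj_sum_encode) auto
  ultimately show ?thesis
    using X Y by (simp add: dp_swap_abs dp_leadsto.abs_eq dp_natural.abs_eq dp_rel_refl)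
qed

interpretation natural: levi_monoid "(\<natural>)" dp_empty dp_size
proof
  fix P Q P' Q' :: dp
  assume "P \<natural> Q = P' \<natural> Q'"
  then have "dp_swap P \<leadsto> dp_swap Q = dp_swap P' \<leadsto> dp_swap Q'"
    by (simp add: natural_eq_swap dp_swap_eq_iff)
  from leadsto_levi[OF this] show
    "\<exists>R. (P' = P \<natural> R \<and> Q = R \<natural> Q') \<or> (P = P' \<natural> R \<and> Q' = R \<natural> Q)"
    unfolding natural_eq_swap dp_swap_eq_iff by (metis dp_swap_swap)
qed (simp_all add: natural_eq_swap leadsto.assoc dp_size_leadsto dp_size_eq_0)

lemma indecomposable1_swap: "indecomposable1 (dp_swap P) \<longleftrightarrow> indecomposable2 P"
proof -
  obtain X where "double_poset X" "P = abs_dp X" by (rule dp_cases)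
  then show ?thesis
    by (simp add: dp_swap_abs indecomposable1.abs_eq indecomposable2.abs_eq dp_rel_refl)
      (simp add: swap_dposet_def indecomposable1_dposet_def indecomposable2_dposet_def)
qed

lemma natural_atom_iff: "natural.atom P \<longleftrightarrow> P \<noteq> dp_empty \<and> indecomposable2 P"
proof -
  have "natural.atom P \<longleftrightarrow> leadsto.atom (dp_swap P)"
    unfolding natural.atom_def leadsto.atom_def natural_eq_swap
    by (metis dp_swap_swap dp_swap_empty)
  then show ?thesis
    by (simp add: leadsto_atom_iff indecomposable1_swap dp_swap_eq_iff)
qed

section \<open>No double poset decomposes for both products\<close>

text \<open>A pair separated by \<open>I\<close> is incomparable for the first order, and one separated by \<open>J\<close> is
  comparable, so \<open>J\<close> separates no pair that \<open>I\<close> separates. If \<open>I\<close> is proper, any two elements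
  are linked by pairs that \<open>I\<close> separates, so \<open>J\<close> separates nothing.\<close>

lemma cut_and_swapped_cut:
  assumes "leadsto_cut X I" "leadsto_cut (swap_dposet X) J"
  shows "I = {} \<or> I = carr X \<or> J = {} \<or> J = carr X"
proof (rule ccontr)
  assume "\<not> ?thesis"
  moreover have sub: "I \<subseteq> carr X" "J \<subseteq> carr X"
    using assms by (auto simp: leadsto_cut_def swap_dposet_def)
  ultimately obtain x y u v where xy: "x \<in> I" "y \<in> carr X - I" and uv: "u \<in> J" "v \<in> carr X - J"
    by blast
  have agree: "z \<in> J \<longleftrightarrow> w \<in> J" if "z \<in> I" "w \<in> carr X - I" for z w
  proof -
    have "z \<in> carr X" using that sub by blast
    then show ?thesis
      using that assms unfolding leadsto_cut_def swap_dposet_def dposet.simps by blast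
  qed
  \<comment> \<open>An element of \<open>I\<close> is linked to \<open>x\<close> through \<open>y\<close>, any other element directly.\<close>
  have "z \<in> J \<longleftrightarrow> x \<in> J" if "z \<in> carr X" for z
    using agree[of z y] agree[of x y] agree[of x z] xy that by blast
  then show False using uv sub by blast
qed

lemma leadsto_natural_disjoint:
  assumes "P \<leadsto> Q = R \<natural> S"
  shows "P = dp_empty \<or> Q = dp_empty \<or> R = dp_empty \<or> S = dp_empty"
proof -
  obtain X where X: "double_poset X" "P \<leadsto> Q = abs_dp X" by (rule dp_cases)
  obtain I where I: "leadsto_cut X I" "P = abs_dp (subposet X I)" "Q = abs_dp (subposet X (- I))"
    using X by (metis leadsto_cutE)
  have "abs_dp (swap_dposet X) = dp_swap R \<leadsto> dp_swap S"
    using X assms by (metis dp_swap_abs dp_swap_swap natural_eq_swap)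
  then obtain J where J: "leadsto_cut (swap_dposet X) J"
      "dp_swap R = abs_dp (subposet (swap_dposet X) J)"
      "dp_swap S = abs_dp (subposet (swap_dposet X) (- J))"
    using X by (metis leadsto_cutE double_poset_swap)
  have "I \<subseteq> carr X" "J \<subseteq> carr X" using I J by (auto simp: leadsto_cut_def swap_dposet_def)
  then have "P = dp_empty \<longleftrightarrow> I = {}" "Q = dp_empty \<longleftrightarrow> I = carr X"
    "dp_swap R = dp_empty \<longleftrightarrow> J = {}" "dp_swap S = dp_empty \<longleftrightarrow> J = carr X"
    using X I J by (auto simp: abs_dp_eq_empty_iff double_poset_subposet swap_dposet_def
        double_poset_swap[unfolded swap_dposet_def])
  then show ?thesis using cut_and_swapped_cut[OF I(1) J(1)] by (auto simp: dp_swap_eq_iff)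
qed

interpretation dp: double_levi_monoid "(\<leadsto>)" "(\<natural>)" dp_empty dp_size
  by unfold_locales (rule leadsto_natural_disjoint)

lemma both_atoms_iff:
  "leadsto.atom P \<and> natural.atom P \<longleftrightarrow> P \<noteq> dp_empty \<and> indecomposable12 P"
  by (auto simp: leadsto_atom_iff natural_atom_iff indecomposable12_def)

section \<open>Linear extension\<close>

lemma lookup_H_scale [simp]:
  "Poly_Mapping.lookup (H_scale c u) P = c * Poly_Mapping.lookup u P"
  by (simp add: H_scale_def Poly_Mapping.map.rep_eq when_def)

lemma H_vector_space: "vector_space H_scale"
  by unfold_locales (auto intro!: poly_mapping_eqI simp: lookup_add algebra_simps)

definition linear_extension ::
  "('k::field \<Rightarrow> 'a::ab_group_add \<Rightarrow> 'a) \<Rightarrow> (dp \<Rightarrow> 'a) \<Rightarrow> (dp \<Rightarrow>\<^sub>0 'k) \<Rightarrow> 'a" where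
  "linear_extension s g u =
     (\<Sum>P\<in>Poly_Mapping.keys u. s (Poly_Mapping.lookup u P) (g P))"

lemma linear_extension_superset:
  assumes "vector_space s" "finite A" "Poly_Mapping.keys u \<subseteq> A"
  shows "linear_extension s g u = (\<Sum>P\<in>A. s (Poly_Mapping.lookup u P) (g P))"
proof -
  interpret vector_space s by fact
  show ?thesis
    unfolding linear_extension_def using assms
    by (intro sum.mono_neutral_left) (auto simp: in_keys_iff)
qed

lemma linear_linear_extension:
  assumes s: "vector_space s"
  shows "Vector_Spaces.linear H_scale s (linear_extension s g)"
  unfolding Vector_Spaces.linear_iff
proof (intro conjI allI)
  interpret vector_space s by fact
  fix u v :: "dp \<Rightarrow>\<^sub>0 'a" and c :: 'a
  have "Poly_Mapping.keys (u + v) \<subseteq> Poly_Mapping.keys u \<union> Poly_Mapping.keys v"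
    by (rule Poly_Mapping.keys_add)
  then show "linear_extension s g (u + v) = linear_extension s g u + linear_extension s g v"
    using linear_extension_superset[OF s, of "Poly_Mapping.keys u \<union> Poly_Mapping.keys v"]
    by (simp add: lookup_add scale_left_distrib sum.distrib)
  have "Poly_Mapping.keys (H_scale c u) \<subseteq> Poly_Mapping.keys u"
    by (auto simp: in_keys_iff)
  then show "linear_extension s g (H_scale c u) = s c (linear_extension s g u)"
    using linear_extension_superset[OF s, of "Poly_Mapping.keys u"]
    by (simp add: scale_sum_right)
qed (use s H_vector_space in auto)

lemma linear_extension_basis [simp]:
  "vector_space s \<Longrightarrow> linear_extension s g (H_basis P) = g P"
  by (simp add: linear_extension_def H_basis_def vector_space.vector_space_assms(4))

lemma linear_imp_linear_extension:
  assumes "Vector_Spaces.linear H_scale s f"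
  shows "f u = linear_extension s (\<lambda>P. f (H_basis P)) u"
proof -
  interpret f: Vector_Spaces.linear H_scale s f by fact
  have "u = (\<Sum>P\<in>Poly_Mapping.keys u. H_scale (Poly_Mapping.lookup u P) (H_basis P))"
    by (rule poly_mapping_eqI)
      (simp add: lookup_sum H_basis_def lookup_single when_def in_keys_iff if_distrib cong: if_cong)
  then have "f u = f (\<Sum>P\<in>Poly_Mapping.keys u. H_scale (Poly_Mapping.lookup u P) (H_basis P))"
    by simp
  then show ?thesis by (simp add: linear_extension_def f.sum f.scale)
qed

lemma linear_eq_on_basis:
  assumes "Vector_Spaces.linear H_scale s f" "Vector_Spaces.linear H_scale s g"
    and "\<And>P. f (H_basis P) = g (H_basis P)"
  shows "f u = g u"
  using linear_imp_linear_extension[OF assms(1), of u] linear_imp_linear_extension[OF assms(2), of u]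
    assms(3) by simp

lemma linear_comp:
  assumes "Vector_Spaces.linear r s f" "Vector_Spaces.linear s t g"
  shows "Vector_Spaces.linear r t (\<lambda>x. g (f x))"
  using Vector_Spaces.linear_compose[OF assms] by (simp add: o_def)

lemma bilinear_eq_on_basis:
  assumes "\<And>v. Vector_Spaces.linear H_scale s (\<lambda>u. f u v)" "\<And>u. Vector_Spaces.linear H_scale s (f u)"
    and "\<And>v. Vector_Spaces.linear H_scale s (\<lambda>u. g u v)" "\<And>u. Vector_Spaces.linear H_scale s (g u)"
    and "\<And>P Q. f (H_basis P) (H_basis Q) = g (H_basis P) (H_basis Q)"
  shows "f u v = g u v"
  by (rule linear_eq_on_basis[OF assms(1,3)], rule linear_eq_on_basis[OF assms(2,4)], rule assms(5))

section \<open>Double posets as a free 2-As algebra\<close>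

text \<open>Linearity in either argument is read off by writing the double sum as a linear extension
  in that argument.\<close>

lemma bilinear_extension_left:
  "bilinear_extension m u v =
     linear_extension H_scale (\<lambda>P. linear_extension H_scale (\<lambda>Q. H_basis (m P Q)) v) u"
proof -
  interpret vector_space H_scale by (rule H_vector_space)
  show ?thesis
    by (simp add: bilinear_extension_def linear_extension_def scale_sum_right)
qed

lemma bilinear_extension_right:
  "bilinear_extension m u v =
     linear_extension H_scale (\<lambda>Q. linear_extension H_scale (\<lambda>P. H_basis (m P Q)) u) v"
proof -
  interpret vector_space H_scale by (rule H_vector_space)
  show ?thesis
    unfolding bilinear_extension_def
    by (subst sum.swap) (simp add: linear_extension_def scale_sum_right mult.commute)
qed

lemma linear_bilinear_extension_left:
  "Vector_Spaces.linear H_scale H_scale (\<lambda>u. bilinear_extension m u v)"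
  unfolding bilinear_extension_left by (rule linear_linear_extension[OF H_vector_space])

lemma linear_bilinear_extension_right:
  "Vector_Spaces.linear H_scale H_scale (bilinear_extension m u)"
  unfolding bilinear_extension_right by (rule linear_linear_extension[OF H_vector_space])

lemma bilinear_extension_basis [simp]:
  "bilinear_extension m (H_basis P) (H_basis Q) = H_basis (m P Q)"
  by (simp add: bilinear_extension_left H_vector_space)

lemma bilinear_extension_monoid:
  assumes "monoid m e"
  shows "monoid (bilinear_extension m) (H_basis e :: dp \<Rightarrow>\<^sub>0 'k::field)"
proof
  interpret m: monoid m e by fact
  let ?m = "bilinear_extension m"
  note left = linear_bilinear_extension_left and right = linear_bilinear_extension_right
  fix u v w :: "dp \<Rightarrow>\<^sub>0 'k"
  have id: "Vector_Spaces.linear H_scale H_scale (\<lambda>u :: dp \<Rightarrow>\<^sub>0 'k. u)"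
    using H_vector_space by (rule vector_space.linear_ident)
  show "?m (H_basis e) u = u"
    by (rule linear_eq_on_basis[OF right id]) simp
  show "?m u (H_basis e) = u"
    by (rule linear_eq_on_basis[OF left id]) simp
  have basis: "?m (?m u v) (H_basis R) = ?m u (?m v (H_basis R))" for R
  proof (rule bilinear_eq_on_basis[where f = "\<lambda>u v. ?m (?m u v) (H_basis R)"
        and g = "\<lambda>u v. ?m u (?m v (H_basis R))"])
    show "Vector_Spaces.linear H_scale H_scale (\<lambda>u. ?m (?m u v) (H_basis R))" for v
      by (rule linear_comp[OF left left])
    show "Vector_Spaces.linear H_scale H_scale (\<lambda>v. ?m (?m u v) (H_basis R))" for u
      by (rule linear_comp[OF right left])
    show "Vector_Spaces.linear H_scale H_scale (\<lambda>u. ?m u (?m v (H_basis R)))" for v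
      by (rule left)
    show "Vector_Spaces.linear H_scale H_scale (\<lambda>v. ?m u (?m v (H_basis R)))" for u
      by (rule linear_comp[OF left right])
  qed (simp add: m.assoc)
  show "?m (?m u v) w = ?m u (?m v w)"
  proof (rule linear_eq_on_basis[where f = "?m (?m u v)" and g = "\<lambda>w. ?m u (?m v w)"])
    show "Vector_Spaces.linear H_scale H_scale (?m (?m u v))"
      by (rule right)
    show "Vector_Spaces.linear H_scale H_scale (\<lambda>w. ?m u (?m v w))"
      by (rule linear_comp[OF right right])
  qed (rule basis)
qed

lemma H_two_As_algebra: "two_As_algebra H_scale H_leadsto H_natural H_unit"
  unfolding two_As_algebra_def two_As_algebra_axioms_def H_leadsto_def H_natural_def H_unit_def
  using H_vector_space bilinear_extension_monoid leadsto.monoid_axioms natural.monoid_axioms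
    linear_bilinear_extension_left linear_bilinear_extension_right
  by blast

lemma linear_extension_multiplicative:
  assumes s: "vector_space s"
    and left: "\<And>y. Vector_Spaces.linear s s (\<lambda>x. mA x y)"
    and right: "\<And>x. Vector_Spaces.linear s s (mA x)"
    and g: "\<And>P Q. g (m P Q) = mA (g P) (g Q)"
  shows "linear_extension s g (bilinear_extension m u v) =
    mA (linear_extension s g u) (linear_extension s g v)"
proof (rule bilinear_eq_on_basis[where f = "\<lambda>u v. linear_extension s g (bilinear_extension m u v)"
      and g = "\<lambda>u v. mA (linear_extension s g u) (linear_extension s g v)"])
  note L = linear_linear_extension[OF s]
  show "Vector_Spaces.linear H_scale s (\<lambda>u. linear_extension s g (bilinear_extension m u v))" for v
    by (rule linear_comp[OF linear_bilinear_extension_left L])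
  show "Vector_Spaces.linear H_scale s (\<lambda>v. linear_extension s g (bilinear_extension m u v))" for u
    by (rule linear_comp[OF linear_bilinear_extension_right L])
  show "Vector_Spaces.linear H_scale s (\<lambda>u. mA (linear_extension s g u) (linear_extension s g v))" for v
    by (rule linear_comp[OF L left])
  show "Vector_Spaces.linear H_scale s (\<lambda>v. mA (linear_extension s g u) (linear_extension s g v))" for u
    by (rule linear_comp[OF L right])
qed (simp add: s g)

theorem theorem9:
  fixes scaleA :: "'k::field \<Rightarrow> 'a::ab_group_add \<Rightarrow> 'a"
    and mA1 mA2 :: "'a \<Rightarrow> 'a \<Rightarrow> 'a"
    and unitA :: 'a
    and a :: "dp \<Rightarrow> 'a"
  shows "two_As_algebra (H_scale :: 'k \<Rightarrow> _) H_leadsto H_natural H_unit \<and>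
    (two_As_algebra scaleA mA1 mA2 unitA \<longrightarrow>
      (\<exists>!\<phi> :: (dp \<Rightarrow>\<^sub>0 'k) \<Rightarrow> 'a.
         two_As_hom H_scale H_leadsto H_natural H_unit scaleA mA1 mA2 unitA \<phi> \<and>
         (\<forall>P. P \<noteq> dp_empty \<and> indecomposable12 P \<longrightarrow> \<phi> (H_basis P) = a P)))"
proof (intro conjI impI H_two_As_algebra)
  assume "two_As_algebra scaleA mA1 mA2 unitA"
  then interpret A: two_As_algebra scaleA mA1 mA2 unitA .
  note vs = A.vector_space_axioms
  let ?hom = "two_As_hom H_scale H_leadsto H_natural H_unit scaleA mA1 mA2 unitA"
  let ?gen = "\<lambda>\<phi>. \<forall>P. P \<noteq> dp_empty \<and> indecomposable12 P \<longrightarrow> \<phi> (H_basis P) = a P"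
  define g where "g = dp.evaluate mA1 mA2 unitA a"
  show "\<exists>!\<phi>. ?hom \<phi> \<and> ?gen \<phi>"
  proof (rule ex1I)
    have "linear_extension scaleA g (H_leadsto u v) =
        mA1 (linear_extension scaleA g u) (linear_extension scaleA g v)" for u v
      unfolding H_leadsto_def g_def
      by (rule linear_extension_multiplicative[where mA = mA1])
        (rule vs A.m1_linear_left A.m1_linear_right dp.evaluate_mult1 A.m1_monoid)+
    moreover have "linear_extension scaleA g (H_natural u v) =
        mA2 (linear_extension scaleA g u) (linear_extension scaleA g v)" for u v
      unfolding H_natural_def g_def
      by (rule linear_extension_multiplicative[where mA = mA2])
        (rule vs A.m2_linear_left A.m2_linear_right dp.evaluate_mult2 A.m2_monoid)+
    ultimately have "?hom (linear_extension scaleA g)"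
      using linear_linear_extension[OF vs]
      by (simp add: two_As_hom_def H_unit_def vs g_def dp.evaluate_one)
    moreover have "?gen (linear_extension scaleA g)"
      by (simp add: vs g_def dp.evaluate_atom flip: both_atoms_iff)
    ultimately show "?hom (linear_extension scaleA g) \<and> ?gen (linear_extension scaleA g)" ..
  next
    fix \<phi> assume \<phi>: "?hom \<phi> \<and> ?gen \<phi>"
    have lin: "Vector_Spaces.linear H_scale scaleA \<phi>" and unit: "\<phi> (H_basis dp_empty) = unitA"
      using \<phi> by (simp_all add: two_As_hom_def H_unit_def)
    have mult: "\<phi> (H_basis (P \<leadsto> Q)) = mA1 (\<phi> (H_basis P)) (\<phi> (H_basis Q))"
      "\<phi> (H_basis (P \<natural> Q)) = mA2 (\<phi> (H_basis P)) (\<phi> (H_basis Q))" for P Q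
      using \<phi> unfolding two_As_hom_def H_leadsto_def H_natural_def
      by (metis bilinear_extension_basis)+
    have basis: "\<phi> (H_basis P) = g P" for P
    proof (induction P rule: dp.generated_induct)
      case (atom p)
      then have "p \<noteq> dp_empty \<and> indecomposable12 p" using both_atoms_iff by blast
      with atom \<phi> show ?case by (simp add: g_def dp.evaluate_atom)
    qed (simp_all add: unit mult g_def dp.evaluate_one dp.evaluate_mult1[OF A.m1_monoid]
        dp.evaluate_mult2[OF A.m2_monoid])
    show "\<phi> = linear_extension scaleA g"
      by (rule ext, rule linear_eq_on_basis[OF lin linear_linear_extension[OF vs]])
        (simp add: vs basis)
  qed
qed

end
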